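(* Let $\mathcal S\subseteq\mathcal P(\Omega)$ be a union-closed set system, and let $\mathcal E$ be a spread in $\Omega$. Then at least one of the following conclusions holds: (S) there is a spread $\mathcal G$ that refines $\mathcal E$, and a sequence $(\mathsf a_i)_{i\ge1}$ in $\mathcal S$ which shatters $\mathcal G$; (D) there is a spread $\mathcal F$ that refines $\mathcal E$, and an $\mathcal S$-decisive colouring $\mathcal C$ of $\mathcal F$.
   Context: $\Omega$ is a non-empty set and $\mathcal P(\Omega)$ its power set. Complements are taken in $\Omega$: $\mathsf x^c=\Omega\setminus\mathsf x$. A union-closed set system on $\Omega$ is a subset $\mathcal S\subseteq\mathcal P(\Omega)$ closed under finite (i.e. binary) unions. A spread in $\Omega$ is a sequence $\mathcal E=(E_n)_{n\ge1}$ of finite non-empty, pairwise disjoint subsets of $\Omega$ with $|E_n|\to\infty$. A refinement of $\mathcal E$ is a spread $\mathcal F=(F_j)_{j\ge1}$ such that each $F_j$ is contained in some $E_{n(j)}$, with $n(j)\ne n(k)$ whenever $j\neq k$; we then say $\mathcal F$ refines $\mathcal E$. A sequence $(\mathsf a_j)_{j\ge1}$ of subsets of $\Omega$ shatters a spread $\mathcal E=(E_n)_{n\ge1}$ if, for every $m\in\mathbb N$ and every $m$-tuple $(\mathsf y_1,\dots,\mathsf y_m)$ with $\mathsf y_j\in\{\mathsf a_j,\mathsf a_j^c\}$ for $j=1,\dots,m$, one has $\lim_{n\to\infty}\left|E_n\cap\bigcap_{j=1}^m\mathsf y_j\right|=\infty$. A colouring of a spread $\mathcal E=(E_n)_{n\ge1}$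 is a partition $\mathcal C=\{C_0,\dots,C_d\}$ of $\Omega$ into finitely many disjoint subsets such that $\lim_n|C_j\cap E_n|=\infty$ for each $j=0,\dots,d$. A colouring $\mathcal C$ of $\mathcal E$ is $\mathcal S$-decisive (with respect to $\mathcal E$) if there exists a colour class $C_0\in\mathcal C$ such that every $\mathsf x\in\mathcal S$ satisfies $$\sup_{n\ge1}\ \min\Big(\{|\mathsf x\cap C_0\cap E_n|\}\cup\{|\mathsf x^c\cap C\cap E_n|: C\in\mathcal C\}\Big)<\infty .$$ *)

theory Defs
  imports Complex_Main "HOL-Library.Disjoint_Sets" "HOL-Library.Extended_Nat"
begin

text \<open>
  Sequences \<open>(E\<^sub>n)\<^sub>n\<^sub>\<ge>\<^sub>1\<close> are re-indexed from \<open>0\<close>, as functions on \<^typ>\<open>nat\<close>.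
  Complements are relative to the ground set \<open>\<Omega>\<close>.
\<close>

definition union_closed_system :: "'a set \<Rightarrow> 'a set set \<Rightarrow> bool" where
  "union_closed_system \<Omega> S \<longleftrightarrow> S \<subseteq> Pow \<Omega> \<and> (\<forall>x\<in>S. \<forall>y\<in>S. x \<union> y \<in> S)"

definition spread :: "'a set \<Rightarrow> (nat \<Rightarrow> 'a set) \<Rightarrow> bool" where
  "spread \<Omega> E \<longleftrightarrow>
     (\<forall>n. E n \<subseteq> \<Omega> \<and> finite (E n) \<and> E n \<noteq> {}) \<and>
     disjoint_family E \<and>
     filterlim (\<lambda>n. card (E n)) at_top sequentially"

definition refines_spread :: "'a set \<Rightarrow> (nat \<Rightarrow> 'a set) \<Rightarrow> (nat \<Rightarrow> 'a set) \<Rightarrow> bool" where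
  "refines_spread \<Omega> F E \<longleftrightarrow>
     spread \<Omega> F \<and> (\<exists>\<nu> :: nat \<Rightarrow> nat. inj \<nu> \<and> (\<forall>j. F j \<subseteq> E (\<nu> j)))"

text \<open>
  Only the first \<open>m\<close> values of \<open>y\<close> matter below, so \<open>y\<close> encodes an \<open>m\<close>-tuple. The empty
  intersection (\<open>m = 0\<close>) is \<^term>\<open>UNIV\<close>, which is harmless after intersecting with \<open>E n\<close>.
\<close>

definition shatters :: "'a set \<Rightarrow> (nat \<Rightarrow> 'a set) \<Rightarrow> (nat \<Rightarrow> 'a set) \<Rightarrow> bool" where
  "shatters \<Omega> a E \<longleftrightarrow>
     (\<forall>j. a j \<subseteq> \<Omega>) \<and>
     (\<forall>(m :: nat) (y :: nat \<Rightarrow> 'a set). (\<forall>j<m. y j \<in> {a j, \<Omega> - a j}) \<longrightarrow>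
        filterlim (\<lambda>n. card (E n \<inter> (\<Inter>j<m. y j))) at_top sequentially)"

definition colouring :: "'a set \<Rightarrow> (nat \<Rightarrow> 'a set) \<Rightarrow> 'a set set \<Rightarrow> bool" where
  "colouring \<Omega> E \<C> \<longleftrightarrow>
     finite \<C> \<and> partition_on \<Omega> \<C> \<and>
     (\<forall>C\<in>\<C>. filterlim (\<lambda>n. card (C \<inter> E n)) at_top sequentially)"

definition decisive :: "'a set \<Rightarrow> 'a set set \<Rightarrow> (nat \<Rightarrow> 'a set) \<Rightarrow> 'a set set \<Rightarrow> bool" where
  "decisive \<Omega> S E \<C> \<longleftrightarrow>
     (\<exists>C\<^sub>0\<in>\<C>. \<forall>x\<in>S.
        (SUP n. enat (Min ({card (x \<inter> C\<^sub>0 \<inter> E n)} \<union> {card ((\<Omega> - x) \<inter> C \<inter> E n) | C. C \<in> \<C>}))) < \<infinity>)"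

end

theory Submission
  imports Defs
begin

text \<open>
  Suppose that no colouring of a refinement of \<open>E\<close> is decisive. Given a finite partition all of
  whose classes are simultaneously large on some \<open>E n\<close>, we find a member of \<open>S\<close> which splits every
  class into two large pieces: if \<open>z\<close> already hits some of the classes and its complement hits all
  of them, apply non-decisiveness on the refinement \<open>E n - z\<close> to obtain \<open>x\<close> in \<open>S\<close> hitting one more
  class, and replace \<open>z\<close> by \<open>z \<union> x\<close>; since \<open>x\<close> leaves a large part of each class outside \<open>z\<close>, so
  does \<open>z \<union> x\<close>. Iterating the splitting and choosing the indices diagonally gives a shattered
  refinement.
\<close>

section \<open>Selecting increasing indices\<close>

text \<open>Every index \<open>n\<close> fails from level \<open>B n\<close> on. Adding the bounds
  of all indices below \<open>K\<close> gives a level that rules them all out at once, so witnesses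
  exist beyond any \<open>K\<close>.\<close>

lemma strict_mono_selection:
  fixes P :: "nat \<Rightarrow> nat \<Rightarrow> bool"
  assumes ex: "\<And>N. \<exists>n. P N n"
    and anti: "\<And>N M n. N \<le> M \<Longrightarrow> P M n \<Longrightarrow> P N n"
    and fails: "\<And>n. \<exists>N. \<not> P N n"
  shows "\<exists>\<nu>. strict_mono \<nu> \<and> (\<forall>j. P j (\<nu> j))"
proof -
  obtain B where B: "\<And>n. \<not> P (B n) n"
    using fails by metis
  have large: "\<exists>n\<ge>K. P N n" for N K
  proof -
    obtain n where n: "P (N + sum B {..<K}) n"
      using ex by blast
    have "n \<ge> K"
    proof (rule ccontr)
      assume "\<not> n \<ge> K"
      then have "B n \<le> sum B {..<K}"
        by (intro member_le_sum) auto
      then show False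
        using anti[OF _ n, of "B n"] B by auto
    qed
    moreover have "P N n"
      using anti[OF _ n, of N] by simp
    ultimately show ?thesis by blast
  qed
  have "\<exists>\<nu>. \<forall>j. P j (\<nu> j) \<and> \<nu> j < \<nu> (Suc j)"
  proof (rule dependent_nat_choice)
    show "\<exists>n. P 0 n" by (rule ex)
    show "\<exists>y. P (Suc j) y \<and> x < y" for x j
      using large[of "Suc x" "Suc j"] by auto
  qed
  then show ?thesis
    by (auto simp: strict_mono_Suc_iff)
qed

lemma filterlim_at_top_of_ge_index:
  fixes f :: "nat \<Rightarrow> nat"
  assumes "\<And>n. n \<ge> m \<Longrightarrow> n \<le> f n"
  shows "filterlim f at_top sequentially"
proof (rule filterlim_at_top_mono[OF filterlim_ident])
  show "eventually (\<lambda>n. n \<le> f n) sequentially"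
    using assms by (rule eventually_sequentiallyI)
qed

section \<open>Partitions with simultaneously large classes\<close>

text \<open>One \<open>n\<close> serves all classes at once, but no limit along \<open>E\<close> is
  required; the limits in a colouring are obtained only after passing to a subsequence.\<close>

definition unbounded_on :: "(nat \<Rightarrow> 'a set) \<Rightarrow> 'a set set \<Rightarrow> bool" where
  "unbounded_on E \<C> \<longleftrightarrow> (\<forall>N. \<exists>n. \<forall>C\<in>\<C>. N \<le> card (C \<inter> E n))"

text \<open>Empty pieces are kept, so \<open>unbounded_on\<close> for this family forces
  \<open>a\<close> to cut every class properly.\<close>

definition split_classes :: "'a set set \<Rightarrow> 'a set \<Rightarrow> 'a set set" where
  "split_classes \<C> a = (\<lambda>C. C \<inter> a) ` \<C> \<union> (\<lambda>C. C - a) ` \<C>"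

lemma unbounded_on_selection:
  assumes "\<C> \<noteq> {}" and "unbounded_on E \<C>"
  obtains \<nu> :: "nat \<Rightarrow> nat" where "strict_mono \<nu>"
    and "\<And>j C. C \<in> \<C> \<Longrightarrow> j \<le> card (C \<inter> E (\<nu> j))"
proof -
  have "\<exists>\<nu>. strict_mono \<nu> \<and> (\<forall>j. \<forall>C\<in>\<C>. j \<le> card (C \<inter> E (\<nu> j)))"
  proof (rule strict_mono_selection)
    show "\<exists>n. \<forall>C\<in>\<C>. N \<le> card (C \<inter> E n)" for N
      using assms(2) by (auto simp: unbounded_on_def)
    show "\<exists>N. \<not> (\<forall>C\<in>\<C>. N \<le> card (C \<inter> E n))" for n
      using \<open>\<C> \<noteq> {}\<close> by (metis all_not_in_conv Suc_n_not_le_n)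
  qed auto
  then show thesis using that by blast
qed

lemma partition_on_split_classes:
  assumes "partition_on \<Omega> \<C>" and "{} \<notin> split_classes \<C> a"
  shows "partition_on \<Omega> (split_classes \<C> a)"
proof (rule partition_onI)
  show "\<Union> (split_classes \<C> a) = \<Omega>"
    using partition_onD1[OF assms(1)] by (auto simp: split_classes_def)
  show "disjnt p q" if "p \<in> split_classes \<C> a" "q \<in> split_classes \<C> a" "p \<noteq> q" for p q
    using that partition_onD2[OF assms(1)]
    by (auto simp: split_classes_def disjnt_def disjoint_def)
qed (use assms(2) in auto)

section \<open>Decisiveness and refinements\<close>

text \<open>Non-decisiveness refutes every candidate for the distinguished class, so
  \<open>C\<^sub>0\<close> can be prescribed. For the resulting \<open>x\<close> the minima have
  infinite supremum, hence they exceed every \<open>N\<close>.\<close>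

lemma not_decisiveE:
  assumes "\<not> decisive \<Omega> S F \<C>" and "finite \<C>" and "C\<^sub>0 \<in> \<C>"
  obtains x where "x \<in> S"
    and "\<And>N. \<exists>n. N \<le> card (x \<inter> C\<^sub>0 \<inter> F n) \<and> (\<forall>C\<in>\<C>. N \<le> card ((\<Omega> - x) \<inter> C \<inter> F n))"
proof -
  define A where
    "A x n = {card (x \<inter> C\<^sub>0 \<inter> F n)} \<union> {card ((\<Omega> - x) \<inter> C \<inter> F n) | C. C \<in> \<C>}" for x n
  have fin: "finite (A x n)" for x n
    using \<open>finite \<C>\<close> by (auto simp: A_def)
  have ne: "A x n \<noteq> {}" for x n
    by (simp add: A_def)
  obtain x where x: "x \<in> S" and sup: "\<not> (SUP n. enat (Min (A x n))) < \<infinity>"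
    using assms unfolding decisive_def A_def by blast
  have "\<exists>n. N \<le> card (x \<inter> C\<^sub>0 \<inter> F n) \<and> (\<forall>C\<in>\<C>. N \<le> card ((\<Omega> - x) \<inter> C \<inter> F n))" for N
  proof -
    have "\<exists>n. N \<le> Min (A x n)"
    proof (rule ccontr)
      assume "\<nexists>n. N \<le> Min (A x n)"
      then have "(SUP n. enat (Min (A x n))) \<le> enat N"
        by (intro SUP_least) (auto simp: not_le less_imp_le)
      then show False
        using sup by (metis enat_ord_simps(4) infinity_ileE)
    qed
    then obtain n where "\<forall>k\<in>A x n. N \<le> k"
      using fin ne by auto
    then show ?thesis
      by (intro exI[of _ n]) (auto simp: A_def)
  qed
  with x show thesis by (rule that)
qed

lemma spread_finite: "spread \<Omega> E \<Longrightarrow> finite (E n)"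
  by (simp add: spread_def)

lemma refines_spreadI:
  assumes E: "spread \<Omega> E" and "inj \<nu>" and sub: "\<And>j. F j \<subseteq> E (\<nu> j)" and "\<And>j. F j \<noteq> {}"
    and "filterlim (\<lambda>j. card (F j)) at_top sequentially"
  shows "refines_spread \<Omega> F E"
proof -
  have "disjoint_family F"
    unfolding disjoint_family_on_def
  proof (intro ballI impI)
    fix i j :: nat
    assume "i \<noteq> j"
    then have "E (\<nu> i) \<inter> E (\<nu> j) = {}"
      using E \<open>inj \<nu>\<close> by (auto simp: spread_def disjoint_family_on_def inj_eq)
    then show "F i \<inter> F j = {}"
      using sub[of i] sub[of j] by blast
  qed
  moreover have "F j \<subseteq> \<Omega>" "finite (F j)" for j
    using E sub[of j] by (auto simp: spread_def intro: finite_subset)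
  ultimately show ?thesis
    using assms by (auto simp: refines_spread_def spread_def)
qed

section \<open>Splitting all classes by one member of the system\<close>

text \<open>Induction on the set \<open>\<D>\<close> of classes already hit. It starts from
  \<open>z = {}\<close>, which need not lie in \<open>S\<close> and is therefore adjoined. The
  colouring stays \<open>\<C>\<close> throughout, because \<open>z\<close> is removed from the
  spread and not from the classes.\<close>

lemma hit_classes:
  assumes S: "union_closed_system \<Omega> S" and E: "spread \<Omega> E"
    and indecisive: "\<And>F \<C>. refines_spread \<Omega> F E \<Longrightarrow> colouring \<Omega> F \<C> \<Longrightarrow> \<not> decisive \<Omega> S F \<C>"
    and \<C>: "finite \<C>" "partition_on \<Omega> \<C>" "unbounded_on E \<C>"
    and "finite \<D>" "\<D> \<subseteq> \<C>"
  shows "\<exists>z\<in>insert {} S. unbounded_on E ((\<lambda>C. C \<inter> z) ` \<D> \<union> (\<lambda>C. C - z) ` \<C>)"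
  using \<open>finite \<D>\<close> \<open>\<D> \<subseteq> \<C>\<close>
proof (induction \<D> rule: finite_induct)
  case empty
  then show ?case using \<C>(3) by auto
next
  case (insert C\<^sub>0 \<D>)
  then obtain z where z: "z \<in> insert {} S"
    and unb: "unbounded_on E ((\<lambda>C. C \<inter> z) ` \<D> \<union> (\<lambda>C. C - z) ` \<C>)"
    by blast
  have C\<^sub>0: "C\<^sub>0 \<in> \<C>" using insert.prems by simp
  obtain \<nu> where \<nu>: "strict_mono \<nu>"
    and big: "\<And>j C. C \<in> (\<lambda>C. C \<inter> z) ` \<D> \<union> (\<lambda>C. C - z) ` \<C> \<Longrightarrow> j \<le> card (C \<inter> E (\<nu> j))"
    using unbounded_on_selection[OF _ unb] C\<^sub>0 by blast
  have in_z: "j \<le> card (C \<inter> z \<inter> E (\<nu> j))" if "C \<in> \<D>" for j C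
    using big that by blast
  have out_z: "j \<le> card ((C - z) \<inter> E (\<nu> j))" if "C \<in> \<C>" for j C
    using big that by blast
  \<comment> \<open>The shift by one makes every \<open>F j\<close> non-empty.\<close>
  define F where "F j = E (\<nu> (Suc j)) - z" for j
  have F_large: "Suc j \<le> card (C \<inter> F j)" if "C \<in> \<C>" for C j
  proof -
    have "C \<inter> F j = (C - z) \<inter> E (\<nu> (Suc j))"
      by (auto simp: F_def)
    then show ?thesis using out_z[OF that, of "Suc j"] by simp
  qed
  have fin: "finite (F j)" for j
    using spread_finite[OF E] by (simp add: F_def)
  have card_F: "Suc j \<le> card (F j)" for j
    using F_large[OF C\<^sub>0, of j] card_mono[OF fin, of "C\<^sub>0 \<inter> F j" j] by simp
  have "refines_spread \<Omega> F E"
  proof (rule refines_spreadI[OF E, of "\<lambda>j. \<nu> (Suc j)"])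
    show "inj (\<lambda>j. \<nu> (Suc j))"
      using strict_mono_eq[OF \<nu>] by (auto intro: injI)
    show "F j \<noteq> {}" for j
      using card_F[of j] by auto
    show "filterlim (\<lambda>j. card (F j)) at_top sequentially"
      by (rule filterlim_at_top_of_ge_index) (use card_F Suc_leD in blast)
  qed (auto simp: F_def)
  moreover have "colouring \<Omega> F \<C>"
    unfolding colouring_def
  proof (intro conjI ballI \<C>)
    show "filterlim (\<lambda>j. card (C \<inter> F j)) at_top sequentially" if "C \<in> \<C>" for C
      by (rule filterlim_at_top_of_ge_index) (use F_large[OF that] Suc_leD in blast)
  qed
  ultimately have "\<not> decisive \<Omega> S F \<C>"
    by (rule indecisive)
  then obtain x where x: "x \<in> S"
    and x_large: "\<And>N. \<exists>n. N \<le> card (x \<inter> C\<^sub>0 \<inter> F n) \<and> (\<forall>C\<in>\<C>. N \<le> card ((\<Omega> - x) \<inter> C \<inter> F n))"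
    using not_decisiveE \<C>(1) C\<^sub>0 by blast
  \<comment> \<open>The indices supplied by \<open>x_large\<close> must also grow: the classes in
    \<open>\<D>\<close> are known to meet \<open>z\<close> in many points only at large
    indices.\<close>
  have "\<exists>\<mu>. strict_mono \<mu> \<and> (\<forall>j. j \<le> card (x \<inter> C\<^sub>0 \<inter> F (\<mu> j)) \<and>
      (\<forall>C\<in>\<C>. j \<le> card ((\<Omega> - x) \<inter> C \<inter> F (\<mu> j))))"
  proof (rule strict_mono_selection[OF x_large])
    show "\<exists>N. \<not> (N \<le> card (x \<inter> C\<^sub>0 \<inter> F n) \<and> (\<forall>C\<in>\<C>. N \<le> card ((\<Omega> - x) \<inter> C \<inter> F n)))" for n
      using Suc_n_not_le_n by blast
  qed auto
  then obtain \<mu> where \<mu>: "strict_mono \<mu>"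
    and hit: "\<And>j. j \<le> card (x \<inter> C\<^sub>0 \<inter> F (\<mu> j))"
    and miss: "\<And>j C. C \<in> \<C> \<Longrightarrow> j \<le> card ((\<Omega> - x) \<inter> C \<inter> F (\<mu> j))"
    by blast
  have "unbounded_on E ((\<lambda>C. C \<inter> (z \<union> x)) ` insert C\<^sub>0 \<D> \<union> (\<lambda>C. C - (z \<union> x)) ` \<C>)"
    unfolding unbounded_on_def
  proof (intro allI exI)
    fix N
    \<comment> \<open>This is the set of \<open>E\<close> from which \<open>F (\<mu> N)\<close> was
      cut.\<close>
    let ?n = "\<nu> (Suc (\<mu> N))"
    have finE: "finite (A \<inter> E ?n)" for A
      using spread_finite[OF E] by simp
    have "N \<le> card (C\<^sub>0 \<inter> (z \<union> x) \<inter> E ?n)"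
      using hit[of N] by (rule order_trans[OF _ card_mono[OF finE]]) (auto simp: F_def)
    moreover have "N \<le> card (C \<inter> (z \<union> x) \<inter> E ?n)" if "C \<in> \<D>" for C
    proof -
      have "N \<le> Suc (\<mu> N)"
        using strict_mono_imp_increasing[OF \<mu>, of N] by simp
      also have "\<dots> \<le> card (C \<inter> z \<inter> E ?n)"
        by (rule in_z[OF that])
      also have "\<dots> \<le> card (C \<inter> (z \<union> x) \<inter> E ?n)"
        by (rule card_mono[OF finE]) auto
      finally show ?thesis .
    qed
    \<comment> \<open>\<open>F\<close> avoids \<open>z\<close>, so its points outside
      \<open>x\<close> lie outside \<open>z \<union> x\<close>.\<close>
    moreover have "N \<le> card ((C - (z \<union> x)) \<inter> E ?n)" if "C \<in> \<C>" for C
      using miss[OF that, of N] by (rule order_trans[OF _ card_mono[OF finE]]) (auto simp: F_def)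
    ultimately show "\<forall>C\<in>(\<lambda>C. C \<inter> (z \<union> x)) ` insert C\<^sub>0 \<D> \<union> (\<lambda>C. C - (z \<union> x)) ` \<C>.
        N \<le> card (C \<inter> E ?n)"
      by auto
  qed
  moreover have "z \<union> x \<in> S"
    using z x S by (auto simp: union_closed_system_def)
  ultimately show ?case by blast
qed

text \<open>This is \<open>hit_classes\<close> with all of \<open>\<C>\<close> to be hit. Some
  \<open>E n\<close> meets every piece, so no piece is empty; this gives the partition and excludes
  \<open>a = {}\<close>, so that \<open>a\<close> lies in \<open>S\<close> itself.\<close>

lemma ex_splitting:
  assumes S: "union_closed_system \<Omega> S" and E: "spread \<Omega> E"
    and indecisive: "\<And>F \<C>. refines_spread \<Omega> F E \<Longrightarrow> colouring \<Omega> F \<C> \<Longrightarrow> \<not> decisive \<Omega> S F \<C>"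
    and \<C>: "finite \<C>" "\<C> \<noteq> {}" "partition_on \<Omega> \<C>" "unbounded_on E \<C>"
  shows "\<exists>a\<in>S. partition_on \<Omega> (split_classes \<C> a) \<and> unbounded_on E (split_classes \<C> a)"
proof -
  obtain a where a: "a \<in> insert {} S" and unb: "unbounded_on E (split_classes \<C> a)"
    using hit_classes[OF S E indecisive \<C>(1,3,4) \<C>(1) order_refl] unfolding split_classes_def by blast
  obtain n where n: "\<forall>C\<in>split_classes \<C> a. 1 \<le> card (C \<inter> E n)"
    using unb unfolding unbounded_on_def by blast
  then have no_empty: "{} \<notin> split_classes \<C> a"
    by force
  then have "a \<noteq> {}"
    using \<C>(2) by (auto simp: split_classes_def)
  then show ?thesis
    using a unb partition_on_split_classes[OF \<C>(3) no_empty] by auto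
qed

section \<open>Iterated splitting and the shattered refinement\<close>

theorem theorem4p4:
  fixes \<Omega> :: "'a set" and S :: "'a set set" and E :: "nat \<Rightarrow> 'a set"
  assumes "\<Omega> \<noteq> {}"
    and "union_closed_system \<Omega> S"
    and "spread \<Omega> E"
  shows "(\<exists>G a. refines_spread \<Omega> G E \<and> (\<forall>i. a i \<in> S) \<and> shatters \<Omega> a G) \<or>
         (\<exists>F \<C>. refines_spread \<Omega> F E \<and> colouring \<Omega> F \<C> \<and> decisive \<Omega> S F \<C>)"
proof (rule disjCI)
  assume "\<nexists>F \<C>. refines_spread \<Omega> F E \<and> colouring \<Omega> F \<C> \<and> decisive \<Omega> S F \<C>"
  then have indecisive:
    "\<not> decisive \<Omega> S F \<C>" if "refines_spread \<Omega> F E" "colouring \<Omega> F \<C>" for F \<C>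
    using that by blast
  have E: "E n \<subseteq> \<Omega>" "finite (E n)" "E n \<noteq> {}" for n
    using assms(3) by (auto simp: spread_def)
  define good where
    "good \<C> \<longleftrightarrow> finite \<C> \<and> \<C> \<noteq> {} \<and> partition_on \<Omega> \<C> \<and> unbounded_on E \<C>" for \<C>
  have "good {\<Omega>}"
  proof -
    have "\<exists>n. N \<le> card (\<Omega> \<inter> E n)" for N
    proof -
      have "eventually (\<lambda>n. N \<le> card (E n)) sequentially"
        using assms(3) by (auto simp: spread_def filterlim_at_top)
      then have "\<exists>n. N \<le> card (E n)"
        by (auto simp: eventually_sequentially)
      then show ?thesis
        using E(1) by (simp add: Int_absorb1)
    qed
    then show ?thesis
      using assms(1) by (auto simp: good_def unbounded_on_def intro: partition_on_space)
  qed
  have step: "\<exists>\<C>'. good \<C>' \<and> (\<exists>a\<in>S. \<C>' = split_classes \<C> a)" if good: "good \<C>" for \<C>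
  proof -
    obtain a where "a \<in> S" "partition_on \<Omega> (split_classes \<C> a)" "unbounded_on E (split_classes \<C> a)"
      using ex_splitting[OF assms(2,3) indecisive, where \<C> = \<C>] good unfolding good_def by blast
    moreover have "finite (split_classes \<C> a)" "split_classes \<C> a \<noteq> {}"
      using good by (simp_all add: good_def split_classes_def)
    ultimately show ?thesis
      unfolding good_def by blast
  qed
  \<comment> \<open>The clause for \<open>k = 0\<close> pins the initial partition, which dependent
    choice would otherwise leave open; \<open>atoms\<close> relies on it.\<close>
  have "\<exists>\<K>. \<forall>k. (good (\<K> k) \<and> (k = 0 \<longrightarrow> \<K> k = {\<Omega>})) \<and> (\<exists>a\<in>S. \<K> (Suc k) = split_classes (\<K> k) a)"
  proof (rule dependent_nat_choice)
    show "\<exists>\<C>. good \<C> \<and> (0 = 0 \<longrightarrow> \<C> = {\<Omega>})"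
      using \<open>good {\<Omega>}\<close> by blast
    show "\<exists>\<C>'. (good \<C>' \<and> (Suc k = 0 \<longrightarrow> \<C>' = {\<Omega>})) \<and> (\<exists>a\<in>S. \<C>' = split_classes \<C> a)"
      if "good \<C> \<and> (k = 0 \<longrightarrow> \<C> = {\<Omega>})" for \<C> k
      using step[of \<C>] that by blast
  qed
  then obtain \<K> where good: "\<And>k. good (\<K> k)" and \<K>0: "\<K> 0 = {\<Omega>}"
    and ex_a: "\<forall>k. \<exists>a. a \<in> S \<and> \<K> (Suc k) = split_classes (\<K> k) a"
    by metis
  obtain a where a: "\<And>k. a k \<in> S" and \<K>Suc: "\<And>k. \<K> (Suc k) = split_classes (\<K> k) (a k)"
    using choice[OF ex_a] by blast
  have finer: "\<exists>C'\<in>\<K> n. C' \<subseteq> C" if "C \<in> \<K> m" "m \<le> n" for C m n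
    using that(2)
  proof (induction n rule: dec_induct)
    case base
    then show ?case using that(1) by blast
  next
    case (step n)
    then obtain C' where "C' \<in> \<K> n" "C' \<subseteq> C" by blast
    then have "C' \<inter> a n \<in> \<K> (Suc n)" "C' \<inter> a n \<subseteq> C"
      by (auto simp: \<K>Suc split_classes_def)
    then show ?case by blast
  qed
  \<comment> \<open>Shattering thus reduces to a limit for each class of each \<open>\<K> m\<close>.
    The factor \<open>\<Omega>\<close> turns the empty intersection at \<open>m = 0\<close> into the
    sole class of \<open>\<K> 0\<close>.\<close>
  have atoms: "\<Omega> \<inter> (\<Inter>j<m. y j) \<in> \<K> m" if "\<forall>j<m. y j \<in> {a j, \<Omega> - a j}" for m y
    using that
  proof (induction m)
    case 0
    then show ?case by (simp add: \<K>0)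
  next
    case (Suc m)
    let ?A = "\<Omega> \<inter> (\<Inter>j<m. y j)"
    have "?A \<in> \<K> m" using Suc by simp
    moreover have "\<Omega> \<inter> (\<Inter>j<Suc m. y j) \<in> {?A \<inter> a m, ?A - a m}"
      using Suc.prems by (auto simp: lessThan_Suc)
    ultimately show ?case
      by (auto simp: \<K>Suc split_classes_def)
  qed
  \<comment> \<open>Diagonal choice: the \<open>j\<close>-th index need only serve the
    \<open>j\<close>-th partition. Coarser partitions inherit the bound because each of their
    classes contains a class of the finer one.\<close>
  have "\<exists>\<nu>. strict_mono \<nu> \<and> (\<forall>j. \<forall>C\<in>\<K> j. j \<le> card (C \<inter> E (\<nu> j)))"
  proof (rule strict_mono_selection)
    show "\<exists>n. \<forall>C\<in>\<K> N. N \<le> card (C \<inter> E n)" for N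
      using good[of N] by (simp add: good_def unbounded_on_def)
    show "\<forall>C\<in>\<K> N. N \<le> card (C \<inter> E n)"
      if "N \<le> M" and M: "\<forall>C\<in>\<K> M. M \<le> card (C \<inter> E n)" for N M n
    proof
      fix C
      assume "C \<in> \<K> N"
      then obtain C' where "C' \<in> \<K> M" "C' \<subseteq> C"
        using finer \<open>N \<le> M\<close> by blast
      then have "M \<le> card (C' \<inter> E n)" "card (C' \<inter> E n) \<le> card (C \<inter> E n)"
        using M E(2) by (auto intro!: card_mono)
      then show "N \<le> card (C \<inter> E n)"
        using \<open>N \<le> M\<close> by simp
    qed
    show "\<exists>N. \<not> (\<forall>C\<in>\<K> N. N \<le> card (C \<inter> E n))" for n
    proof -
      let ?N = "Suc (card (E n))"
      obtain C where "C \<in> \<K> ?N"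
        using good[of ?N] by (auto simp: good_def)
      moreover have "card (C \<inter> E n) \<le> card (E n)"
        using E(2) by (intro card_mono) auto
      ultimately show ?thesis
        by (intro exI[of _ ?N]) force
    qed
  qed
  then obtain \<nu> where \<nu>: "strict_mono \<nu>" and large: "\<And>j C. C \<in> \<K> j \<Longrightarrow> j \<le> card (C \<inter> E (\<nu> j))"
    by blast
  define G where "G j = E (\<nu> j)" for j
  \<comment> \<open>For \<open>n \<ge> m\<close>, the class \<open>C\<close> contains a class of
    \<open>\<K> n\<close>, which already has at least \<open>n\<close> points in
    \<open>G n\<close>.\<close>
  have lim: "filterlim (\<lambda>n. card (C \<inter> G n)) at_top sequentially" if C: "C \<in> \<K> m" for C m
  proof (rule filterlim_at_top_of_ge_index)
    fix n
    assume "m \<le> n"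
    then obtain C' where "C' \<in> \<K> n" "C' \<subseteq> C"
      using finer[OF C] by blast
    then show "n \<le> card (C \<inter> G n)"
      unfolding G_def using large E(2)
      by (meson Int_mono card_mono finite_Int order_refl order_trans)
  qed
  have "refines_spread \<Omega> G E"
  proof (rule refines_spreadI[OF assms(3) strict_mono_imp_inj_on[OF \<nu>]])
    \<comment> \<open>The growth of \<open>G\<close> is the case of the class
      \<open>\<Omega>\<close> of \<open>\<K> 0\<close>.\<close>
    show "filterlim (\<lambda>j. card (G j)) at_top sequentially"
      using lim[of \<Omega> 0] E(1) by (simp add: \<K>0 G_def Int_absorb1)
  qed (use E in \<open>auto simp: G_def\<close>)
  moreover have "shatters \<Omega> a G"
    unfolding shatters_def
  proof (intro conjI allI impI)
    show "a j \<subseteq> \<Omega>" for j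
      using a assms(2) by (auto simp: union_closed_system_def)
    fix m :: nat and y
    assume "\<forall>j<m. y j \<in> {a j, \<Omega> - a j}"
    then have "filterlim (\<lambda>n. card (\<Omega> \<inter> (\<Inter>j<m. y j) \<inter> G n)) at_top sequentially"
      by (rule lim[OF atoms])
    moreover have "\<Omega> \<inter> (\<Inter>j<m. y j) \<inter> G n = G n \<inter> (\<Inter>j<m. y j)" for n
      using E(1) by (auto simp: G_def)
    ultimately show "filterlim (\<lambda>n. card (G n \<inter> (\<Inter>j<m. y j))) at_top sequentially"
      by simp
  qed
  ultimately show "\<exists>G a. refines_spread \<Omega> G E \<and> (\<forall>i. a i \<in> S) \<and> shatters \<Omega> a G"
    using a by blast
qed

end
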